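(* Let $N \geq 2$ be an integer, and let $C = \{c_1 < c_2 < \cdots < c_r\}$ and $C^* = \{c_1^* < c_2^* < \cdots < c_s^*\}$ be two sorted change-point sets, i.e. (possibly empty) subsets of $\{1,\ldots,N-1\}$ of sizes $r$ and $s$ respectively. Define $c_0 = c_0^* = 0$ and $c_{r+1} = c_{s+1}^* = N$. Identify $C$ with the clustering $\{\{c_i+1,\ldots,c_{i+1}\} : 0 \le i \le r\}$ of $\{1,\ldots,N\}$ and $C^*$ with the clustering $\{\{c_j^*+1,\ldots,c_{j+1}^*\} : 0 \le j \le s\}$ of $\{1,\ldots,N\}$. Then the Rand Index $RI$ between these two clusterings is given by $$RI = 1 - \frac{\sum_{i=0}^{r}\sum_{j=0}^{s} n_{ij}\,|c_{i+1} - c_{j+1}^*|}{\binom{N}{2}},$$ where $$n_{ij} = \max\left(0,\ \min\left(c_{i+1},c_{j+1}^*\right) - \max\left(c_{i},c_{j}^*\right)\right).$$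
   Context: A clustering of $\{1,\ldots,N\}$ is a partition of $\{1,\ldots,N\}$ into nonempty sets, called clusters. For a clustering $P$ and $i,j\in\{1,\ldots,N\}$, let $I_P(i,j) = 1$ if $i$ and $j$ belong to the same cluster of $P$ and $I_P(i,j)=0$ otherwise. Given two clusterings $P_1,P_2$ of $\{1,\ldots,N\}$, define $$N_{11} = |\{(i,j)\in\{1,\ldots,N\}^2 : i<j,\ I_{P_1}(i,j) = 1 = I_{P_2}(i,j)\}|,$$ $$N_{00} = |\{(i,j)\in\{1,\ldots,N\}^2 : i<j,\ I_{P_1}(i,j) = 0 = I_{P_2}(i,j)\}|.$$ The Rand Index between $P_1$ and $P_2$ is $RI = \dfrac{N_{00}+N_{11}}{\binom{N}{2}}$. *)

theory Defs
  imports Complex_Main "HOL-Library.Disjoint_Sets"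
begin

definition is_clustering :: "nat \<Rightarrow> nat set set \<Rightarrow> bool" where
  "is_clustering N P \<longleftrightarrow> partition_on {1..N} P"

definition same_cluster :: "nat set set \<Rightarrow> nat \<Rightarrow> nat \<Rightarrow> nat" where
  "same_cluster P i j = (if \<exists>A\<in>P. i \<in> A \<and> j \<in> A then 1 else 0)"

definition N11 :: "nat \<Rightarrow> nat set set \<Rightarrow> nat set set \<Rightarrow> nat" where
  "N11 N P Q = card {(i, j). (i, j) \<in> {1..N} \<times> {1..N} \<and> i < j \<and>
     same_cluster P i j = 1 \<and> same_cluster Q i j = 1}"

definition N00 :: "nat \<Rightarrow> nat set set \<Rightarrow> nat set set \<Rightarrow> nat" where
  "N00 N P Q = card {(i, j). (i, j) \<in> {1..N} \<times> {1..N} \<and> i < j \<and>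
     same_cluster P i j = 0 \<and> same_cluster Q i j = 0}"

definition rand_index :: "nat \<Rightarrow> nat set set \<Rightarrow> nat set set \<Rightarrow> real" where
  "rand_index N P Q = (real (N00 N P Q) + real (N11 N P Q)) / real (N choose 2)"

text \<open>
  The set \<open>C\<close> is \<open>{c 1 < \<dots> < c r}\<close>, contained in \<open>{1..N - 1}\<close>, and \<open>c\<close> is extended by the
  boundary values \<open>c 0 = 0\<close> and \<open>c (r + 1) = N\<close>; values of \<open>c\<close> beyond \<open>r + 1\<close> are irrelevant.
  By \<open>sorted_change_points_card\<close> and \<open>sorted_change_points_exists\<close>, \<open>C\<close> determines \<open>r\<close> as its
  cardinality and every such \<open>C\<close> has an enumeration of this kind.
\<close>

definition sorted_change_points :: "nat \<Rightarrow> nat set \<Rightarrow> nat \<Rightarrow> (nat \<Rightarrow> nat) \<Rightarrow> bool" where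
  "sorted_change_points N C r c \<longleftrightarrow>
     C \<subseteq> {1..N - 1} \<and> C = c ` {1..r} \<and> strict_mono_on {1..r} c \<and>
     c 0 = 0 \<and> c (r + 1) = N"

definition change_point_clustering :: "nat \<Rightarrow> (nat \<Rightarrow> nat) \<Rightarrow> nat set set" where
  "change_point_clustering r c = {{c i + 1..c (i + 1)} | i. i \<le> r}"

text \<open>The subtraction is taken in the reals, so that it is not truncated.\<close>

definition overlap :: "(nat \<Rightarrow> nat) \<Rightarrow> (nat \<Rightarrow> nat) \<Rightarrow> nat \<Rightarrow> nat \<Rightarrow> real" where
  "overlap c c' i j =
     max 0 (min (real (c (i + 1))) (real (c' (j + 1))) - max (real (c i)) (real (c' j)))"

lemma sorted_change_points_card:
  assumes "sorted_change_points N C r c"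
  shows "card C = r"
  using assms unfolding sorted_change_points_def
  by (metis card_image card_atLeastAtMost diff_Suc_1 strict_mono_on_imp_inj_on)

lemma sorted_change_points_exists:
  assumes "C \<subseteq> {1..N - 1}"
  shows "\<exists>c. sorted_change_points N C (card C) c"
proof -
  have fin: "finite C" using assms finite_subset by blast
  define xs where "xs = sorted_list_of_set C"
  have len: "length xs = card C" and set_xs: "set xs = C"
    and sorted: "sorted_wrt (<) xs"
    using fin by (simp_all add: xs_def)
  define c where "c i = (if i = 0 then 0 else if i \<le> card C then xs ! (i - 1) else N)" for i
  have "c ` {1..card C} = (\<lambda>i. xs ! i) ` {..<card C}"
  proof -
    have "{1..card C} = Suc ` {..<card C}"
      by (metis One_nat_def image_Suc_lessThan)
    then have "c ` {1..card C} = (\<lambda>i. c (Suc i)) ` {..<card C}" by (simp only: image_image)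
    also have "\<dots> = (\<lambda>i. xs ! i) ` {..<card C}" by (rule image_cong) (auto simp: c_def)
    finally show ?thesis .
  qed
  also have "\<dots> = C"
    using set_xs len by (auto simp: set_conv_nth)
  finally have "C = c ` {1..card C}" by simp
  moreover have "strict_mono_on {1..card C} c"
  proof (rule strict_mono_onI)
    fix i j assume "i \<in> {1..card C}" "j \<in> {1..card C}" "i < j"
    then show "c i < c j"
      using sorted_wrt_nth_less[OF sorted, of "i - 1" "j - 1"] len by (auto simp: c_def)
  qed
  ultimately show ?thesis
    using assms by (auto simp: sorted_change_points_def c_def intro!: exI[of _ c])
qed

lemma sorted_change_points_less:
  assumes "sorted_change_points N C r c" "N \<ge> 1" "i \<le> r"
  shows "c i < c (i + 1)"
proof -
  have range: "1 \<le> c k \<and> c k \<le> N - 1" if "k \<in> {1..r}" for k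
    using assms(1) that unfolding sorted_change_points_def by fastforce
  consider "i = 0" "r = 0" | "i = 0" "r > 0" | "i > 0" "i = r" | "i > 0" "i < r"
    using assms(3) by linarith
  then show ?thesis
  proof cases
    case 4
    then show ?thesis
      using assms(1) unfolding sorted_change_points_def by (auto elim!: strict_mono_onD)
  qed (use assms range[of 1] range[of r] in \<open>auto simp: sorted_change_points_def\<close>)
qed

lemma is_clustering_change_point_clustering:
  assumes "sorted_change_points N C r c" "N \<ge> 1"
  shows "is_clustering N (change_point_clustering r c)"
proof -
  have less: "c i < c (i + 1)" if "i \<le> r" for i
    using sorted_change_points_less[OF assms that] .
  have mono: "c i \<le> c j" if "i \<le> j" "j \<le> r + 1" for i j
    using that
  proof (induction j rule: dec_induct)
    case (step n)
    then show ?case using less[of n] by simp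
  qed simp
  have ends: "c 0 = 0" "c (r + 1) = N"
    using assms(1) by (simp_all add: sorted_change_points_def)
  have cover: "\<exists>i\<le>r. c i < x \<and> x \<le> c (i + 1)" if "1 \<le> x" "x \<le> N" for x
  proof -
    have "\<exists>i<k. c i < x \<and> x \<le> c (i + 1)" if "x \<le> c k" for k
      using that
    proof (induction k)
      case 0
      then show ?case using \<open>1 \<le> x\<close> ends by simp
    next
      case (Suc k)
      show ?case
      proof (cases "x \<le> c k")
        case True
        then show ?thesis using Suc.IH less_SucI by blast
      next
        case False
        then show ?thesis using Suc.prems by auto
      qed
    qed
    from this[of "r + 1"] show ?thesis using ends that by (auto simp: less_Suc_eq_le)
  qed
  have disj: "{c i + 1..c (i + 1)} \<inter> {c j + 1..c (j + 1)} = {}" if "i < j" "j \<le> r" for i j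
    using mono[of "i + 1" j] that by auto
  show ?thesis
    unfolding is_clustering_def
  proof (rule partition_onI)
    show "\<Union>(change_point_clustering r c) = {1..N}"
    proof (intro equalityI subsetI)
      fix x assume "x \<in> \<Union>(change_point_clustering r c)"
      then obtain i where "i \<le> r" "c i + 1 \<le> x" "x \<le> c (i + 1)"
        by (auto simp: change_point_clustering_def)
      then show "x \<in> {1..N}" using mono[of "i + 1" "r + 1"] ends by simp
    next
      fix x assume "x \<in> {1..N}"
      then obtain i where "i \<le> r" "c i < x" "x \<le> c (i + 1)"
        using cover[of x] by auto
      then have "x \<in> {c i + 1..c (i + 1)}" by simp
      then show "x \<in> \<Union>(change_point_clustering r c)"
        using \<open>i \<le> r\<close> unfolding change_point_clustering_def by blast
    qed
  next
    fix A B
    assume "A \<in> change_point_clustering r c" "B \<in> change_point_clustering r c" "A \<noteq> B"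
    then obtain i j where ij: "i \<le> r" "j \<le> r" "A = {c i + 1..c (i + 1)}"
        "B = {c j + 1..c (j + 1)}" "i \<noteq> j"
      by (auto simp: change_point_clustering_def)
    then show "disjnt A B"
      using disj[of i j] disj[of j i] unfolding disjnt_def by (metis Int_commute nat_neq_iff)
  next
    show "{} \<notin> change_point_clustering r c"
      using less by (fastforce simp: change_point_clustering_def)
  qed
qed

end

theory Submission
  imports Defs
begin

text \<open>
  Let \<open>x < y\<close>, and let \<open>x\<close> lie in the \<open>i\<close>-th block of the first clustering and in the \<open>j\<close>-th block
  of the second one. Since blocks are intervals, \<open>y\<close> shares the cluster of \<open>x\<close> iff \<open>y\<close> does not exceed
  the right end \<open>c (i + 1)\<close>, respectively \<open>c' (j + 1)\<close>. The clusterings therefore disagree on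
  \<open>(x, y)\<close> iff \<open>y\<close> lies between the two right ends, which leaves \<open>\<bar>c (i + 1) - c' (j + 1)\<bar>\<close>
  choices of \<open>y\<close> for each of the \<open>overlap c c' i j\<close> choices of \<open>x\<close>.
\<close>

lemma card_increasing_pairs:
  "card {(i, j). (i, j) \<in> {1..N} \<times> {1..N} \<and> i < j} = N choose 2"
proof (induction N)
  case (Suc N)
  let ?T = "\<lambda>N. {(i, j). (i, j) \<in> {1..N} \<times> {1..N} \<and> i < (j :: nat)}"
  have "?T (Suc N) = ?T N \<union> {1..N} \<times> {Suc N}" by auto
  moreover have "finite (?T N)" by (rule finite_subset[of _ "{1..N} \<times> {1..N}"]) auto
  moreover have "?T N \<inter> {1..N} \<times> {Suc N} = {}" by auto
  ultimately have "card (?T (Suc N)) = (N choose 2) + N"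
    using Suc by (simp add: card_Un_disjoint)
  \<comment> \<open>Pascal's rule, with \<open>N choose 1 = N\<close>; writing 2 as a successor lets
    the recursion for binomials apply.\<close>
  then show ?case by (simp add: numeral_2_eq_2)
qed simp

lemma sorted_change_points_mono:
  assumes "sorted_change_points N C r c" "N \<ge> 1" "i \<le> j" "j \<le> r + 1"
  shows "c i \<le> c j"
  using assms(3,4)
proof (induction j rule: dec_induct)
  case (step n)
  then show ?case using sorted_change_points_less[OF assms(1,2), of n] by simp
qed simp

lemma change_point_block_unique:
  assumes "sorted_change_points N C r c" "N \<ge> 1" "i \<le> r" "k \<le> r"
    and "x \<in> {c i + 1..c (i + 1)}" "x \<in> {c k + 1..c (k + 1)}"
  shows "i = k"
proof (rule ccontr)
  assume "i \<noteq> k"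
  \<comment> \<open>The first case gives \<open>x \<le> c (i + 1) \<le> c k < x\<close>; the second
    is symmetric.\<close>
  then consider "i + 1 \<le> k" | "k + 1 \<le> i" by linarith
  then show False
    by cases (use assms sorted_change_points_mono[OF assms(1,2), of "i + 1" k]
        sorted_change_points_mono[OF assms(1,2), of "k + 1" i] in auto)
qed

lemma change_point_block_exists:
  assumes "sorted_change_points N C r c" "N \<ge> 1" "x \<in> {1..N}"
  obtains i where "i \<le> r" "x \<in> {c i + 1..c (i + 1)}"
proof -
  have "\<Union>(change_point_clustering r c) = {1..N}"
    using is_clustering_change_point_clustering[OF assms(1,2)]
    by (simp add: is_clustering_def partition_on_def)
  then have "x \<in> \<Union>(change_point_clustering r c)"
    using assms(3) by simp
  then show thesis
    using that unfolding change_point_clustering_def by blast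
qed

text \<open>Only block \<open>i\<close> contains \<open>x\<close>, so no other block can witness a
  shared cluster; its left end is already below \<open>y\<close> because
  \<open>c i < x < y\<close>.\<close>

lemma same_cluster_change_point_iff:
  assumes "sorted_change_points N C r c" "N \<ge> 1" "i \<le> r"
    and "x \<in> {c i + 1..c (i + 1)}" "x < y"
  shows "same_cluster (change_point_clustering r c) x y = (if y \<le> c (i + 1) then 1 else 0)"
proof -
  have "(\<exists>A\<in>change_point_clustering r c. x \<in> A \<and> y \<in> A) \<longleftrightarrow> y \<le> c (i + 1)"
  proof
    assume "\<exists>A\<in>change_point_clustering r c. x \<in> A \<and> y \<in> A"
    then obtain k where k: "k \<le> r" "x \<in> {c k + 1..c (k + 1)}" "y \<in> {c k + 1..c (k + 1)}"
      by (auto simp: change_point_clustering_def)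
    then have "i = k" using change_point_block_unique assms(1-4) by blast
    then show "y \<le> c (i + 1)" using k by simp
  next
    assume "y \<le> c (i + 1)"
    then have "y \<in> {c i + 1..c (i + 1)}" using assms(4,5) by simp
    then show "\<exists>A\<in>change_point_clustering r c. x \<in> A \<and> y \<in> A"
      using assms(3,4) unfolding change_point_clustering_def by blast
  qed
  then show ?thesis by (simp add: same_cluster_def)
qed

definition disagreements :: "nat \<Rightarrow> nat set set \<Rightarrow> nat set set \<Rightarrow> (nat \<times> nat) set" where
  "disagreements N P Q = {(i, j). (i, j) \<in> {1..N} \<times> {1..N} \<and> i < j \<and>
     same_cluster P i j \<noteq> same_cluster Q i j}"

text \<open>The pairs counted by \<open>N00\<close>, those counted by \<open>N11\<close> and the
  disagreements partition the \<open>N choose 2\<close> increasing pairs, so it suffices to count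
  disagreements.\<close>

lemma rand_index_eq_disagreements:
  assumes "N \<ge> 2"
  shows "rand_index N P Q = 1 - real (card (disagreements N P Q)) / real (N choose 2)"
proof -
  let ?T = "{(i, j). (i, j) \<in> {1..N} \<times> {1..N} \<and> i < j}"
  let ?E = "\<lambda>b. {(i, j). (i, j) \<in> {1..N} \<times> {1..N} \<and> i < j \<and>
     same_cluster P i j = b \<and> same_cluster Q i j = b}"
  let ?D = "disagreements N P Q"
  have "finite ?T" by (rule finite_subset[of _ "{1..N} \<times> {1..N}"]) auto
  \<comment> \<open>\<open>same_cluster\<close> takes only the values 0 and 1, so two equal values
    are both 0 or both 1.\<close>
  moreover have T: "?T = (?E 0 \<union> ?E 1) \<union> ?D"
    by (auto simp: disagreements_def same_cluster_def)
  ultimately have fin: "finite (?E 0 \<union> ?E 1)" "finite ?D" by simp_all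
  have "card ?T = card (?E 0 \<union> ?E 1) + card ?D"
    unfolding T by (rule card_Un_disjoint[OF fin]) (auto simp: disagreements_def)
  also have "card (?E 0 \<union> ?E 1) = card (?E 0) + card (?E 1)"
    by (rule card_Un_disjoint) (use fin in auto)
  finally have "N choose 2 = N00 N P Q + N11 N P Q + card ?D"
    unfolding card_increasing_pairs N00_def N11_def .
  then have "real (N choose 2) = real (N00 N P Q) + real (N11 N P Q) + real (card ?D)"
    by (metis of_nat_add)
  moreover have "real (N choose 2) > 0"
    using assms by simp
  ultimately show ?thesis by (simp add: rand_index_def field_simps)
qed

text \<open>The intersection runs from the larger left end plus 1 to the smaller right end. When it
  is empty, truncated subtraction on naturals yields the same 0 as the \<open>max 0\<close> in
  \<open>overlap\<close>.\<close>

lemma card_block_Int: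
  "real (card ({c i + 1..c (i + 1)} \<inter> {c' j + 1..c' (j + 1)})) = overlap c c' i j"
  by (auto simp: overlap_def max_def min_def)

lemma card_disagreements:
  assumes "N \<ge> 1" and C: "sorted_change_points N C r c" and C': "sorted_change_points N C' s c'"
  shows "real (card (disagreements N (change_point_clustering r c) (change_point_clustering s c'))) =
    (\<Sum>i=0..r. \<Sum>j=0..s. overlap c c' i j * \<bar>real (c (i + 1)) - real (c' (j + 1))\<bar>)"
proof -
  let ?D = "disagreements N (change_point_clustering r c) (change_point_clustering s c')"
  define B where "B i j = {c i + 1..c (i + 1)} \<inter> {c' j + 1..c' (j + 1)}" for i j
  define G where "G i j = {min (c (i + 1)) (c' (j + 1)) + 1..max (c (i + 1)) (c' (j + 1))}" for i j
  let ?I = "{0..r} \<times> {0..s}"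
  have le: "c (i + 1) \<le> N" "c' (j + 1) \<le> N" if "i \<le> r" "j \<le> s" for i j
    using sorted_change_points_mono[OF C assms(1), of "i + 1" "r + 1"]
      sorted_change_points_mono[OF C' assms(1), of "j + 1" "s + 1"] that C C'
    by (simp_all add: sorted_change_points_def)
  have iff: "(x, y) \<in> ?D \<longleftrightarrow> y \<in> G i j"
    if "i \<le> r" "j \<le> s" "x \<in> B i j" for x y i j
  proof (cases "x < y")
    case True
    have x: "x \<in> {c i + 1..c (i + 1)}" "x \<in> {c' j + 1..c' (j + 1)}"
      using that(3) unfolding B_def by blast+
    have "(x, y) \<in> ?D \<longleftrightarrow> y \<le> N \<and> (y \<le> c (i + 1) \<longleftrightarrow> \<not> y \<le> c' (j + 1))"
      using True x(1) le[OF that(1,2)]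
      by (simp add: disagreements_def same_cluster_change_point_iff[OF C assms(1) that(1) x(1) True]
          same_cluster_change_point_iff[OF C' assms(1) that(2) x(2) True])
    \<comment> \<open>Being at most exactly one of the two right ends means exceeding the smaller
      and not the larger; both ends are at most \<open>N\<close>, which gives
      \<open>y \<le> N\<close>.\<close>
    also have "\<dots> \<longleftrightarrow> y \<in> G i j"
      using le[OF that(1,2)] by (auto simp: G_def)
    finally show ?thesis .
  next
    \<comment> \<open>Both sides fail here: \<open>x\<close> is at most both right ends, so every
      element of \<open>G i j\<close> exceeds \<open>x\<close>.\<close>
    case False
    then show ?thesis using that by (auto simp: disagreements_def B_def G_def)
  qed
  \<comment> \<open>Once the blocks of \<open>x\<close> are fixed, the possible \<open>y\<close> no
    longer depend on \<open>x\<close>, so each pair of blocks contributes a rectangle.\<close>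
  have D: "?D = (\<Union>(i, j)\<in>?I. B i j \<times> G i j)"
  proof (intro equalityI subsetI)
    fix p assume p: "p \<in> ?D"
    obtain x y where xy: "p = (x, y)" by fastforce
    with p have x: "x \<in> {1..N}" by (simp add: disagreements_def)
    obtain i where i: "i \<le> r" "x \<in> {c i + 1..c (i + 1)}"
      using change_point_block_exists[OF C assms(1) x] .
    obtain j where j: "j \<le> s" "x \<in> {c' j + 1..c' (j + 1)}"
      using change_point_block_exists[OF C' assms(1) x] .
    have "x \<in> B i j" using i j unfolding B_def by blast
    then show "p \<in> (\<Union>(i, j)\<in>?I. B i j \<times> G i j)"
      using iff[of i j x y] i(1) j(1) p xy
      by (intro UN_I[of "(i, j)"]) simp_all
  next
    fix p assume "p \<in> (\<Union>(i, j)\<in>?I. B i j \<times> G i j)"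
    then show "p \<in> ?D" using iff by auto
  qed
  \<comment> \<open>The first factors alone separate the rectangles: distinct index pairs differ in
    a block of at least one clustering.\<close>
  have "B i j \<inter> B k l = {}"
    if "i \<le> r" "k \<le> r" "j \<le> s" "l \<le> s" "(i, j) \<noteq> (k, l)" for i j k l
    using change_point_block_unique[OF C assms(1) that(1,2)]
      change_point_block_unique[OF C' assms(1) that(3,4)] that(5)
    unfolding B_def by blast
  then have "\<forall>p\<in>?I. \<forall>q\<in>?I. p \<noteq> q \<longrightarrow>
      (case p of (i, j) \<Rightarrow> B i j \<times> G i j) \<inter> (case q of (i, j) \<Rightarrow> B i j \<times> G i j) = {}"
    by (auto simp: Times_Int_Times)
  moreover have "\<forall>p\<in>?I. finite (case p of (i, j) \<Rightarrow> B i j \<times> G i j)"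
    by (auto simp: B_def G_def)
  ultimately have "card ?D = (\<Sum>p\<in>?I. card (case p of (i, j) \<Rightarrow> B i j \<times> G i j))"
    unfolding D by (intro card_UN_disjoint) simp_all
  also have "\<dots> = (\<Sum>i=0..r. \<Sum>j=0..s. card (B i j) * card (G i j))"
    by (simp add: sum.cartesian_product card_cartesian_product split_def)
  also have "real \<dots> = (\<Sum>i=0..r. \<Sum>j=0..s. real (card (B i j)) * real (card (G i j)))"
    by simp
  also have "\<dots> = (\<Sum>i=0..r. \<Sum>j=0..s. overlap c c' i j * \<bar>real (c (i + 1)) - real (c' (j + 1))\<bar>)"
  proof -
    \<comment> \<open>The cardinality is maximum minus minimum of the right ends, a subtraction that
      never truncates.\<close>
    have "real (card (G i j)) = \<bar>real (c (i + 1)) - real (c' (j + 1))\<bar>" for i j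
      by (auto simp: G_def max_def min_def)
    then show ?thesis by (simp only: B_def card_block_Int)
  qed
  finally show ?thesis .
qed

theorem theorem3p1:
  fixes N r s :: nat and C C' :: "nat set" and c c' :: "nat \<Rightarrow> nat"
  assumes "N \<ge> 2"
    and "sorted_change_points N C r c"
    and "sorted_change_points N C' s c'"
  shows "rand_index N (change_point_clustering r c) (change_point_clustering s c') =
    1 - (\<Sum>i=0..r. \<Sum>j=0..s. overlap c c' i j * \<bar>real (c (i + 1)) - real (c' (j + 1))\<bar>)
          / real (N choose 2)"
  using card_disagreements[OF _ assms(2,3)] assms(1)
  by (simp add: rand_index_eq_disagreements)

end
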